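(* If $D = 2^{3k}(2j+1)$ for some integers $k, j \geq 0$, then the $2$-adic valuation tree of $x^3 + D$ is infinite.
   Context: $\nu_2(n)$ denotes the $2$-adic valuation of the integer $n$: $\nu_2(n)=r$ where $n = 2^r b$ with $2\nmid b$ (and $\nu_2(0)=+\infty$). The $2$-adic valuation tree of $f(x) = x^3 + D$ is the rooted binary tree whose nodes at level $\ell \ge 0$ correspond to residue classes modulo $2^\ell$, defined as follows. The root (level $0$) is the class of all integers $x$. A node corresponding to a class $r \bmod 2^\ell$ is terminating (has no children) if $\nu_2(f(x))$ takes the same value for all integers $x \equiv r \pmod{2^\ell}$; otherwise it is non-terminating and has exactly two children at level $\ell+1$, the classes $r \bmod 2^{\ell+1}$ and $r + 2^\ell \bmod 2^{\ell+1}$. The tree is infinite if it has infinitely many nodes (equivalently, nodes at every level), and finite otherwise. *)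

theory Defs
  imports "HOL-Number_Theory.Number_Theory" "HOL-Library.Extended_Nat"
begin

(* The value at 0 is set by hand: the library has multiplicity p 0 = 0. *)
definition nu2 :: "int \<Rightarrow> enat" where
  "nu2 n = (if n = 0 then \<infinity> else enat (multiplicity 2 n))"

definition residue_class :: "nat \<Rightarrow> int \<Rightarrow> int set" where
  "residue_class l r = {x. [x = r] (mod 2 ^ l)}"

definition terminating :: "(int \<Rightarrow> int) \<Rightarrow> int set \<Rightarrow> bool" where
  "terminating f C \<longleftrightarrow> (\<exists>v. \<forall>x\<in>C. nu2 (f x) = v)"

(* A node is a pair (level, residue class modulo 2 ^ level). The representative r
   is arbitrary; replacing it by another one at most swaps the two children. *)
inductive_set valuation_tree :: "(int \<Rightarrow> int) \<Rightarrow> (nat \<times> int set) set"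
  for f :: "int \<Rightarrow> int" where
  root: "(0, UNIV) \<in> valuation_tree f"
| child0: "(l, residue_class l r) \<in> valuation_tree f \<Longrightarrow> \<not> terminating f (residue_class l r) \<Longrightarrow>
    (Suc l, residue_class (Suc l) r) \<in> valuation_tree f"
| child1: "(l, residue_class l r) \<in> valuation_tree f \<Longrightarrow> \<not> terminating f (residue_class l r) \<Longrightarrow>
    (Suc l, residue_class (Suc l) (r + 2 ^ l)) \<in> valuation_tree f"

end

theory Submission
  imports Defs
begin

text \<open>The tree is infinite because \<open>x ^ 3 + D\<close> has a 2-adic zero. The two facts about it that
  matter can be stated over the integers: values of \<open>x ^ 3 + D\<close> are divisible by arbitrarily
  high powers of 2, but every residue class contains integers at which it does not vanish.

  For the first fact (\<open>odd_is_minus_cube_mod_power_of_two\<close>), \<open>D\<close> is \<open>2 ^ (3 * k)\<close> times an odd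
  number \<open>d\<close>, so substituting \<open>x = 2 ^ k * y\<close> leaves \<open>y ^ 3 + d\<close>. Its derivative \<open>3 * y ^ 2\<close> is
  odd at odd \<open>y\<close>, and Hensel's argument lifts a zero modulo 2 to a zero modulo every power of 2.

  For the passage to the tree (\<open>infinite_valuation_tree\<close>), call a residue class rich if \<open>f x = x ^ 3 + D\<close> takes
  values on it that are divisible by arbitrarily high powers of 2. A rich class is
  non-terminating, since the only constant valuation it admits is \<open>\<infinity>\<close>, which would make \<open>f\<close>
  vanish on all of it. Moreover one of its two halves is rich again. Starting from the
  root, this yields a rich node at every level. Following rich classes instead of the zero itself
  avoids constructing the 2-adic integers.\<close>

lemma residue_class_0 [simp]: "residue_class 0 r = UNIV"
  by (simp add: residue_class_def)

lemma residue_class_halves: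
  "residue_class l r = residue_class (Suc l) r \<union> residue_class (Suc l) (r + 2 ^ l)"
proof (intro Set.set_eqI iffI)
  fix x assume "x \<in> residue_class l r"
  then obtain q where q: "x - r = 2 ^ l * q"
    by (auto simp: residue_class_def cong_iff_dvd_diff dvd_def)
  show "x \<in> residue_class (Suc l) r \<union> residue_class (Suc l) (r + 2 ^ l)"
  proof (cases "even q")
    case True
    then show ?thesis
      using q by (auto simp: residue_class_def cong_iff_dvd_diff elim!: evenE)
  next
    case False
    then obtain p where "q = 2 * p + 1" by (rule oddE)
    then have "x - (r + 2 ^ l) = 2 ^ Suc l * p"
      using q by (simp add: algebra_simps)
    then show ?thesis
      by (simp add: residue_class_def cong_iff_dvd_diff)
  qed
next
  fix x assume "x \<in> residue_class (Suc l) r \<union> residue_class (Suc l) (r + 2 ^ l)"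
  then have "2 ^ Suc l dvd x - r \<or> 2 ^ Suc l dvd x - (r + 2 ^ l)"
    by (simp add: residue_class_def cong_iff_dvd_diff)
  then have "2 ^ l dvd x - r \<or> 2 ^ l dvd x - (r + 2 ^ l)"
    by (metis dvd_trans le_imp_power_dvd le_add2 plus_1_eq_Suc)
  then have "2 ^ l dvd x - r"
    by (metis diff_diff_eq dvd_diff_commute dvd_diffD dvd_refl diff_add_cancel dvd_add)
  then show "x \<in> residue_class l r"
    by (simp add: residue_class_def cong_iff_dvd_diff)
qed

lemma enat_le_nu2_iff: "enat n \<le> nu2 a \<longleftrightarrow> 2 ^ n dvd a"
  by (simp add: nu2_def power_dvd_iff_le_multiplicity)

text \<open>A finite valuation bounds the powers of 2 that divide the value, so a constant valuation on
  a class with unboundedly divisible values can only be \<open>\<infinity>\<close>.\<close>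

lemma not_terminating_if_unbounded_divisibility:
  assumes "\<And>n. \<exists>x\<in>C. 2 ^ n dvd f x" and "\<exists>x\<in>C. f x \<noteq> 0"
  shows "\<not> terminating f C"
proof
  assume "terminating f C"
  then obtain v where v: "\<And>x. x \<in> C \<Longrightarrow> nu2 (f x) = v"
    by (auto simp: terminating_def)
  have "enat n \<le> v" for n
    using assms(1)[of n] v by (auto simp: enat_le_nu2_iff[symmetric])
  then have "v = \<infinity>"
    by (metis enat.exhaust enat_ord_simps(1) not_less_eq_eq order_refl)
  then show False
    using assms(2) v by (metis enat.distinct(1) nu2_def)
qed

text \<open>The invariant of the descent: if both halves of a class had a bound on the powers
  of 2 dividing the values, the larger of the two would bound the whole class.\<close>

lemma unbounded_divisibility_Un:
  fixes f :: "int \<Rightarrow> int"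
  assumes "\<And>n. \<exists>x\<in>A \<union> B. 2 ^ n dvd f x"
  shows "(\<forall>n. \<exists>x\<in>A. 2 ^ n dvd f x) \<or> (\<forall>n. \<exists>x\<in>B. 2 ^ n dvd f x)"
proof (rule ccontr)
  assume "\<not> ?thesis"
  then obtain a b where ab: "\<forall>x\<in>A. \<not> 2 ^ a dvd f x" "\<forall>x\<in>B. \<not> 2 ^ b dvd f x"
    by blast
  obtain x where "x \<in> A \<union> B" "2 ^ max a b dvd f x"
    using assms by blast
  moreover from this have "2 ^ a dvd f x" "2 ^ b dvd f x"
    by (meson dvd_trans le_imp_power_dvd max.cobounded1 max.cobounded2)+
  ultimately show False
    using ab by blast
qed

theorem infinite_valuation_tree:
  assumes unbounded: "\<And>n. \<exists>x. 2 ^ n dvd f x"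
    and nonzero: "\<And>l r. \<exists>x\<in>residue_class l r. f x \<noteq> 0"
  shows "infinite (valuation_tree f)"
proof -
  have "\<exists>r. (l, residue_class l r) \<in> valuation_tree f \<and>
      (\<forall>n. \<exists>x\<in>residue_class l r. 2 ^ n dvd f x)" for l
  proof (induction l)
    case 0
    show ?case
      using unbounded valuation_tree.root[of f] by simp
  next
    case (Suc l)
    then obtain r where node: "(l, residue_class l r) \<in> valuation_tree f"
      and rich: "\<And>n. \<exists>x\<in>residue_class l r. 2 ^ n dvd f x"
      by blast
    have "\<not> terminating f (residue_class l r)"
      using rich nonzero by (rule not_terminating_if_unbounded_divisibility)
    then have "(Suc l, residue_class (Suc l) r) \<in> valuation_tree f"
      "(Suc l, residue_class (Suc l) (r + 2 ^ l)) \<in> valuation_tree f"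
      using node by (auto intro: valuation_tree.child0 valuation_tree.child1)
    with unbounded_divisibility_Un[OF rich[unfolded residue_class_halves[of l r]]]
    show ?case by blast
  qed
  then have "fst ` valuation_tree f = UNIV"
    by force
  then show ?thesis
    by (metis finite_imageI infinite_UNIV_nat)
qed

text \<open>Hensel lifting. If \<open>n > 0\<close> and \<open>2 ^ n\<close> divides \<open>y ^ 3 + d\<close> exactly, then replacing \<open>y\<close> by \<open>y + 2 ^ n\<close>
  adds \<open>2 ^ n * (3 * y ^ 2)\<close> up to a multiple of \<open>2 ^ (n + 1)\<close>, and the sum of
  two odd multiples of \<open>2 ^ n\<close> is a multiple of \<open>2 ^ (n + 1)\<close>.\<close>

lemma odd_is_minus_cube_mod_power_of_two:
  fixes d :: int
  assumes "odd d"
  shows "\<exists>y. odd y \<and> 2 ^ Suc n dvd y ^ 3 + d"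
proof (induction n)
  case 0
  show ?case
    using assms by (intro exI[of _ 1]) simp
next
  case (Suc n)
  then obtain y q where y: "odd y" and q: "y ^ 3 + d = 2 ^ Suc n * q"
    by (auto simp: dvd_def)
  define e :: int where "e = 2 ^ Suc n"
  have "even e"
    by (simp add: e_def)
  show ?case
  proof (cases "even q")
    case True
    then have "2 ^ Suc (Suc n) dvd y ^ 3 + d"
      unfolding q by (auto elim!: evenE)
    then show ?thesis
      using y by blast
  next
    case False
    have "(y + e) ^ 3 + d = (y ^ 3 + d) + e * (3 * y ^ 2 + 3 * y * e + e ^ 2)"
      by (simp add: algebra_simps power2_eq_square power3_eq_cube)
    also have "\<dots> = e * (q + 3 * y ^ 2 + 3 * y * e + e ^ 2)"
      unfolding q e_def by (simp only: distrib_left add.assoc)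
    finally have "(y + e) ^ 3 + d = e * (q + 3 * y ^ 2 + 3 * y * e + e ^ 2)" .
    moreover have "even (q + 3 * y ^ 2 + 3 * y * e + e ^ 2)"
      using False y \<open>even e\<close> by simp
    ultimately have "e * 2 dvd (y + e) ^ 3 + d"
      by (simp add: mult_dvd_mono)
    then have "2 ^ Suc (Suc n) dvd (y + e) ^ 3 + d"
      by (simp add: e_def mult.commute)
    then show ?thesis
      using y \<open>even e\<close> by (intro exI[of _ "y + e"]) simp
  qed
qed

theorem proposition4p1:
  fixes D :: int and k j :: nat
  assumes "D = 2 ^ (3 * k) * (2 * int j + 1)"
  shows "infinite (valuation_tree (\<lambda>x. x ^ 3 + D))"
proof (rule infinite_valuation_tree)
  fix n :: nat
  obtain y :: int where "2 ^ Suc n dvd y ^ 3 + (2 * int j + 1)"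
    using odd_is_minus_cube_mod_power_of_two[of "2 * int j + 1" n] by auto
  then have "2 ^ n dvd y ^ 3 + (2 * int j + 1)"
    by (rule power_le_dvd) simp
  moreover have "(2 ^ k * y) ^ 3 + D = 2 ^ (3 * k) * (y ^ 3 + (2 * int j + 1))"
    by (simp add: assms power_mult_distrib power_mult[symmetric] mult.commute[of k] distrib_left)
  ultimately have "2 ^ n dvd (2 ^ k * y) ^ 3 + D"
    by simp
  then show "\<exists>x. 2 ^ n dvd x ^ 3 + D" ..
next
  fix l :: nat and r :: int
  \<comment> \<open>Every class contains a nonnegative integer, and \<open>D\<close> is positive.\<close>
  define x where "x = r + 2 ^ l * \<bar>r\<bar>"
  have "1 * \<bar>r\<bar> \<le> 2 ^ l * \<bar>r\<bar>"
    by (rule mult_right_mono) simp_all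
  then have "0 \<le> x"
    by (simp add: x_def)
  moreover have "0 < D"
    by (simp add: assms)
  ultimately have "x ^ 3 + D \<noteq> 0"
    by (metis add_nonneg_pos less_irrefl zero_le_power)
  moreover have "x \<in> residue_class l r"
    by (simp add: x_def residue_class_def cong_iff_dvd_diff)
  ultimately show "\<exists>x\<in>residue_class l r. x ^ 3 + D \<noteq> 0" ..
qed

end
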